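(* Let $r\ge1$ be an integer and let $P_n$ be the path on $n$ vertices, where $n=(2r+1)p+q$ with $p\ge1$ an integer and $q\in\{0,1,\dots,2r\}$. Then: (1) if $q=0$: $M_r^I(P_n)=\frac{(2r+1)p}{2}+1$ if $p$ is even, and $M_r^I(P_n)=\frac{(2r+1)(p-1)}{2}+2r$ if $p$ is odd; (2) if $1\le q\le r+1$: $M_r^I(P_n)=\frac{(2r+1)p}{2}+q$ if $p$ is even, and $M_r^I(P_n)=\frac{(2r+1)(p-1)}{2}+2r+1$ if $p$ is odd; (3) if $r+2\le q\le 2r$: $M_r^I(P_n)=\frac{(2r+1)p}{2}+q-1$ if $p$ is even, and $M_r^I(P_n)=\frac{(2r+1)(p-1)}{2}+2r+1$ if $p$ is odd.
   Context: For a graph $G=(V,E)$ and integer $r\ge1$, $d(x,y)$ is the number of edges in a shortest path between $x$ and $y$, $N_r[x]=\{y\in V: d(x,y)\le r\}$, and for $D\subseteq V$, $D_r(x)=N_r[x]\cap D$. A set $D\subseteq V$ is an $r$-identifying code ($r$-IC) of $G$ if $D_r(x)\neq\emptyset$ for every $x\in V$ and $D_r(x)\neq D_r(y)$ for all distinct $x,y\in V$. $M_r^I(G)$ denotes the minimum cardinality of an $r$-identifying code of $G$. *)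

theory Defs
  imports "Graph_Theory.Pair_Digraph" "HOL-Library.Extended_Nat"
begin

text \<open>
  An undirected simple graph is a \<^locale>\<open>pair_graph\<close>: a finite symmetric loopless
  digraph, each undirected edge being the two opposite arcs.
\<close>

definition path_graph :: "nat \<Rightarrow> nat pair_pre_digraph" where
  "path_graph n =
     \<lparr> pverts = {1..n},
       parcs = {(i, j). i \<in> {1..n} \<and> j \<in> {1..n} \<and> (j = i + 1 \<or> i = j + 1)} \<rparr>"

lemma pair_graph_path_graph: "pair_graph (path_graph n)"
proof
  show "finite (pverts (path_graph n))"
    by (simp add: path_graph_def)
  show "finite (parcs (path_graph n))"
    by (rule finite_subset[of _ "{1..n} \<times> {1..n}"]) (auto simp: path_graph_def)
  show "symmetric (with_proj (path_graph n))"
    by (auto simp: path_graph_def symmetric_def intro!: symI)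
qed (auto simp: path_graph_def)

text \<open>The distance is \<open>\<infinity>\<close> when no path connects the two vertices.\<close>

definition gdist :: "'a pair_pre_digraph \<Rightarrow> 'a \<Rightarrow> 'a \<Rightarrow> enat" where
  "gdist G x y = (INF p \<in> {p. pre_digraph.apath (with_proj G) x p y}. enat (length p))"

definition closed_nbhd :: "'a pair_pre_digraph \<Rightarrow> nat \<Rightarrow> 'a \<Rightarrow> 'a set" where
  "closed_nbhd G r x = {y \<in> pverts G. gdist G x y \<le> enat r}"

definition identifying_set :: "'a pair_pre_digraph \<Rightarrow> nat \<Rightarrow> 'a set \<Rightarrow> 'a \<Rightarrow> 'a set" where
  "identifying_set G r D x = closed_nbhd G r x \<inter> D"

definition is_identifying_code :: "'a pair_pre_digraph \<Rightarrow> nat \<Rightarrow> 'a set \<Rightarrow> bool" where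
  "is_identifying_code G r D \<longleftrightarrow>
     D \<subseteq> pverts G \<and>
     (\<forall>x \<in> pverts G. identifying_set G r D x \<noteq> {}) \<and>
     (\<forall>x \<in> pverts G. \<forall>y \<in> pverts G.
        x \<noteq> y \<longrightarrow> identifying_set G r D x \<noteq> identifying_set G r D y)"

text \<open>
  The infimum in \<^typ>\<open>enat\<close> is attained as soon as a finite code exists and is \<open>\<infinity>\<close>
  otherwise, so a finite value asserts the existence of a code of that cardinality.
\<close>

definition min_identifying_code :: "'a pair_pre_digraph \<Rightarrow> nat \<Rightarrow> enat" where
  "min_identifying_code G r =
     (INF D \<in> {D. finite D \<and> is_identifying_code G r D}. enat (card D))"

end

theory Submission
  imports Defs
begin

text \<open>
  The code vertices separating two consecutive vertices \<open>x\<close> and \<open>x + 1\<close> are \<open>x - r\<close> and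
  \<open>x + r + 1\<close>. Hence, besides domination, a set is a code iff it meets every pair \<open>{i, i + 2 r + 1}\<close>
  of vertices and contains \<open>r\<close> prescribed vertices near each end, where only one vertex of the pair
  exists. Splitting the vertices by their residue modulo \<open>2 r + 1\<close> turns this into vertex covers of
  \<open>2 r + 1\<close> disjoint paths with some end vertices prescribed, and a cover of a path on \<open>k\<close> vertices
  containing \<open>e\<close> of its two ends has at least \<open>(k + e) div 2\<close> elements. If \<open>p\<close> is even and
  \<open>q \<le> r + 1\<close>, domination of the end vertices costs one more vertex. Parity patterns on the
  residue classes attain the bound.
\<close>

section \<open>Distances in the path\<close>

lemma pverts_path_graph [simp]: "pverts (path_graph n) = {1..n}"
  by (simp add: path_graph_def)

text \<open>The bound on the visited vertices carries the induction: it keeps \<open>x\<close> off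
  the path that starts at its neighbour \<open>x'\<close>, so prepending the arc repeats no
  vertex.\<close>

lemma path_graph_apath_exists:
  assumes "x \<in> {1..n}" "y \<in> {1..n}"
  shows "\<exists>p. pre_digraph.apath (with_proj (path_graph n)) x p y \<and> length p = nat \<bar>int x - int y\<bar> \<and>
    set (pre_digraph.awalk_verts (with_proj (path_graph n)) x p) \<subseteq> {min x y..max x y}"
proof -
  interpret pair_graph "path_graph n"
    by (rule pair_graph_path_graph)
  show ?thesis
    using assms
  proof (induction "nat \<bar>int x - int y\<bar>" arbitrary: x)
    case 0
    then show ?case
      by (intro exI[of _ "[]"]) (auto simp: apath_Nil_iff)
  next
    case (Suc k)
    define x' where "x' = (if x < y then x + 1 else x - 1)"
    have x': "x' \<in> {1..n}" "k = nat \<bar>int x' - int y\<bar>"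
      using Suc.hyps(2) Suc.prems by (auto simp: x'_def)
    obtain p where p: "apath x' p y" "length p = k" "set (awalk_verts x' p) \<subseteq> {min x' y..max x' y}"
      using Suc.hyps(1)[OF x'(2,1) Suc.prems(2)] x'(2) by auto
    have arc: "(x, x') \<in> parcs (path_graph n)"
      using Suc.hyps(2) Suc.prems x'(1) by (auto simp: path_graph_def x'_def)
    have sub: "{min x' y..max x' y} \<subseteq> {min x y..max x y} - {x}"
      using Suc.hyps(2) by (auto simp: x'_def)
    have "apath x ((x, x') # p) y"
      using arc p(1,3) sub by (auto simp: apath_Cons_iff)
    moreover have "set (awalk_verts x ((x, x') # p)) \<subseteq> {min x y..max x y}"
      using p(3) sub by auto
    ultimately show ?case
      using p(2) Suc.hyps(2) by (intro exI[of _ "(x, x') # p"]) simp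
  qed
qed

text \<open>Each arc changes the position by exactly one.\<close>

lemma path_graph_awalk_length:
  assumes "pre_digraph.awalk (with_proj (path_graph n)) x p y"
  shows "nat \<bar>int x - int y\<bar> \<le> length p"
proof -
  interpret pair_graph "path_graph n"
    by (rule pair_graph_path_graph)
  show ?thesis
    using assms
  proof (induction p arbitrary: x)
    case Nil
    then show ?case by (simp add: awalk_Nil_iff)
  next
    case (Cons e p)
    then have "(x, snd e) \<in> parcs (path_graph n)" "awalk (snd e) p y"
      by (auto simp: awalk_Cons_iff)
    with Cons.IH[of "snd e"] show ?case
      by (auto simp: path_graph_def)
  qed
qed

lemma gdist_path_graph:
  assumes "x \<in> {1..n}" "y \<in> {1..n}"
  shows "gdist (path_graph n) x y = enat (nat \<bar>int x - int y\<bar>)"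
proof (rule antisym)
  show "gdist (path_graph n) x y \<le> enat (nat \<bar>int x - int y\<bar>)"
    using path_graph_apath_exists[OF assms] unfolding gdist_def by (auto intro: INF_lower2)
  show "enat (nat \<bar>int x - int y\<bar>) \<le> gdist (path_graph n) x y"
    unfolding gdist_def
    by (rule INF_greatest) (auto dest!: path_graph_awalk_length simp: pre_digraph.apath_def)
qed

lemma closed_nbhd_path_graph:
  assumes "x \<in> {1..n}"
  shows "closed_nbhd (path_graph n) r x = {y \<in> {1..n}. x \<le> y + r \<and> y \<le> x + r}"
  unfolding closed_nbhd_def using assms
  by (auto simp: gdist_path_graph)

section \<open>Codes described by consecutive vertices\<close>

text \<open>From here on the vertices are numbered from \<open>0\<close>.\<close>

definition path_code :: "nat \<Rightarrow> nat \<Rightarrow> nat set \<Rightarrow> bool" where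
  "path_code n r W \<longleftrightarrow> W \<subseteq> {..<n} \<and>
     (\<forall>x<n. \<exists>y\<in>W. x \<le> y + r \<and> y \<le> x + r) \<and>
     (\<forall>x. Suc x < n \<longrightarrow> (\<exists>y\<in>W. y + r = x \<or> y = x + r + 1))"

lemma identifying_set_path_graph:
  assumes "x < n" "W \<subseteq> {..<n}"
  shows "identifying_set (path_graph n) r (Suc ` W) (Suc x) = Suc ` {y \<in> W. x \<le> y + r \<and> y \<le> x + r}"
  unfolding identifying_set_def using assms
  by (subst closed_nbhd_path_graph) auto

text \<open>Separating consecutive vertices separates all vertices: the code vertex distinguishing
  \<open>x\<close> from \<open>x + 1\<close> also distinguishes \<open>x\<close> from any later \<open>y\<close> with an overlapping
  neighbourhood, and disjoint neighbourhoods are separated by domination.\<close>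

lemma is_identifying_code_path_graph_iff:
  "is_identifying_code (path_graph n) r (Suc ` W) \<longleftrightarrow> path_code n r W"
proof -
  define S where "S x = {y \<in> W. x \<le> y + r \<and> y \<le> x + r}" for x
  have verts: "pverts (path_graph n) = Suc ` {..<n}"
    by (simp add: image_Suc_lessThan)
  have code_iff: "is_identifying_code (path_graph n) r (Suc ` W) \<longleftrightarrow>
      W \<subseteq> {..<n} \<and> (\<forall>x<n. S x \<noteq> {}) \<and> (\<forall>x<n. \<forall>y<n. x \<noteq> y \<longrightarrow> S x \<noteq> S y)"
  proof (cases "W \<subseteq> {..<n}")
    case True
    then show ?thesis
      unfolding is_identifying_code_def verts
      by (auto simp: identifying_set_path_graph S_def[symmetric] inj_image_eq_iff)
  next
    case False
    then show ?thesis
      unfolding is_identifying_code_def verts by (simp add: inj_image_subset_iff)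
  qed
  have sep: "S x \<noteq> S y" if less: "x < y" "y < n" and
    dom: "\<forall>x<n. S x \<noteq> {}" and
    step: "\<forall>x. Suc x < n \<longrightarrow> (\<exists>y\<in>W. y + r = x \<or> y = x + r + 1)" for x y
  proof
    assume eq: "S x = S y"
    have "Suc x < n"
      using less by linarith
    then obtain z where z: "z \<in> W" "z + r = x \<or> z = x + r + 1"
      using step by blast
    \<comment> \<open>A common code vertex \<open>u\<close> forces y <= x + 2 r. This puts z = x + r
      + 1 within distance r of \<open>y\<close> although it is not within r of \<open>x\<close>; for
      z = x - r the roles are reversed.\<close>
    obtain u where "u \<in> S x"
      using dom less by fastforce
    then have "y \<le> x + 2 * r"
      using eq by (auto simp: S_def)
    moreover have "z \<in> S x \<longleftrightarrow> z \<in> S y"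
      by (simp add: eq)
    ultimately show False
      using z less(1) by (auto simp: S_def)
  qed
  have conv: "\<exists>y\<in>W. y + r = x \<or> y = x + r + 1" if neq: "S x \<noteq> S (Suc x)" for x
  proof -
    obtain z where "(z \<in> S x) \<noteq> (z \<in> S (Suc x))"
      using neq by blast
    then have "z \<in> W" "z + r = x \<or> z = x + r + 1"
      by (auto simp: S_def)
    then show ?thesis
      by blast
  qed
  have "path_code n r W \<longleftrightarrow> W \<subseteq> {..<n} \<and> (\<forall>x<n. S x \<noteq> {}) \<and>
     (\<forall>x. Suc x < n \<longrightarrow> (\<exists>y\<in>W. y + r = x \<or> y = x + r + 1))"
    unfolding path_code_def S_def by auto
  moreover have "(\<forall>x<n. \<forall>y<n. x \<noteq> y \<longrightarrow> S x \<noteq> S y) \<longleftrightarrow>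
     (\<forall>x. Suc x < n \<longrightarrow> (\<exists>y\<in>W. y + r = x \<or> y = x + r + 1))" if "\<forall>x<n. S x \<noteq> {}"
  proof
    assume "\<forall>x<n. \<forall>y<n. x \<noteq> y \<longrightarrow> S x \<noteq> S y"
    then show "\<forall>x. Suc x < n \<longrightarrow> (\<exists>y\<in>W. y + r = x \<or> y = x + r + 1)"
      using conv by simp
  next
    assume step: "\<forall>x. Suc x < n \<longrightarrow> (\<exists>y\<in>W. y + r = x \<or> y = x + r + 1)"
    show "\<forall>x<n. \<forall>y<n. x \<noteq> y \<longrightarrow> S x \<noteq> S y"
      using sep[OF _ _ that step] by (metis linorder_neqE_nat)
  qed
  ultimately show ?thesis
    using code_iff by blast
qed

lemma min_identifying_code_path_graphI:
  assumes "path_code n r W" "card W \<le> v"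
    and "\<And>W. path_code n r W \<Longrightarrow> v \<le> card W"
  shows "min_identifying_code (path_graph n) r = enat v"
proof (rule antisym)
  have "finite W"
    using assms(1) finite_subset unfolding path_code_def by blast
  then show "min_identifying_code (path_graph n) r \<le> enat v"
    unfolding min_identifying_code_def using assms(1,2)
    by (intro INF_lower2[of "Suc ` W"]) (auto simp: is_identifying_code_path_graph_iff card_image)
  show "enat v \<le> min_identifying_code (path_graph n) r"
    unfolding min_identifying_code_def
  proof (rule INF_greatest)
    fix D assume "D \<in> {D. finite D \<and> is_identifying_code (path_graph n) r D}"
    then have D: "is_identifying_code (path_graph n) r D"
      by simp
    then have "D \<subseteq> Suc ` {..<n}"
      by (simp add: is_identifying_code_def image_Suc_lessThan)
    then obtain W where "D = Suc ` W"
      by (auto simp: subset_image_iff)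
    with D assms(3)[of W] show "enat v \<le> enat (card D)"
      by (simp add: is_identifying_code_path_graph_iff card_image)
  qed
qed

section \<open>Vertex covers of paths and counting by residues\<close>

text \<open>Induction on \<open>k\<close>, with equality for a single vertex. A new vertex in
  \<open>S\<close> adds 2 to the right side and at most 2 to the left; if it is not in
  \<open>S\<close>, the previous one is, and the new term 1 is paid for by the lost end
  indicator.\<close>

lemma card_vertex_cover_ge:
  assumes "k \<ge> 1" "\<And>j. Suc j < k \<Longrightarrow> j \<in> S \<or> Suc j \<in> S"
  shows "k + of_bool (0 \<in> S) + of_bool (k - 1 \<in> S) \<le> 2 * card (S \<inter> {..<k}) + 1"
  using assms
proof (induction k rule: nat_induct_at_least)
  case base
  then show ?case by (cases "0 \<in> S") (auto simp: lessThan_Suc)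
next
  case (Suc k)
  have IH: "k + of_bool (0 \<in> S) + of_bool (k - 1 \<in> S) \<le> 2 * card (S \<inter> {..<k}) + 1"
    using Suc by simp
  have "k - 1 \<in> S \<or> k \<in> S"
    using Suc.hyps Suc.prems[of "k - 1"] by simp
  moreover have "card (S \<inter> {..<Suc k}) = card (S \<inter> {..<k}) + of_bool (k \<in> S)"
    by (auto simp: lessThan_Suc)
  ultimately show ?case
    using IH by (auto split: if_splits)
qed

lemma card_even_lessThan: "card {j. j < k \<and> even j} = (k + 1) div 2"
proof (induction k)
  case (Suc k)
  have "{j. j < Suc k \<and> even j} = (if even k then insert k else id) {j. j < k \<and> even j}"
    by (auto simp: less_Suc_eq)
  with Suc show ?case by (auto elim: oddE)
qed simp

lemma card_odd_lessThan: "card {j. j < k \<and> odd j} = k div 2"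
proof (induction k)
  case (Suc k)
  have "{j. j < Suc k \<and> odd j} = (if odd k then insert k else id) {j. j < k \<and> odd j}"
    by (auto simp: less_Suc_eq)
  with Suc show ?case by (auto elim: oddE)
qed simp

lemma card_eq_sum_residue_classes:
  fixes W :: "nat set"
  assumes "finite W" "m > 0"
  shows "card W = (\<Sum>c<m. card {j. c + m * j \<in> W})"
proof -
  let ?f = "\<lambda>c j. c + m * j"
  have inj: "inj_on (?f c) A" for c A
    using assms(2) by (auto simp: inj_on_def)
  have "W = (\<Union>c<m. ?f c ` {j. c + m * j \<in> W})"
  proof (intro equalityI subsetI)
    fix i assume "i \<in> W"
    then show "i \<in> (\<Union>c<m. ?f c ` {j. c + m * j \<in> W})"
      using assms(2) by (intro UN_I[of "i mod m"] image_eqI[of _ _ "i div m"]) auto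
  qed auto
  also have "card \<dots> = (\<Sum>c<m. card (?f c ` {j. c + m * j \<in> W}))"
  proof (rule card_UN_disjoint)
    have "?f c ` {j. c + m * j \<in> W} \<subseteq> W" for c
      by auto
    then show "\<forall>c\<in>{..<m}. finite (?f c ` {j. c + m * j \<in> W})"
      using assms(1) finite_subset by blast
    show "\<forall>c\<in>{..<m}. \<forall>d\<in>{..<m}. c \<noteq> d \<longrightarrow>
        ?f c ` {j. c + m * j \<in> W} \<inter> ?f d ` {j. d + m * j \<in> W} = {}"
    proof (intro ballI impI)
      fix c d assume cd: "c \<in> {..<m}" "d \<in> {..<m}" "c \<noteq> d"
      have "c + m * i \<noteq> d + m * j" for i j
        using cd by (metis lessThan_iff mod_less mod_mult_self2)
      then show "?f c ` {j. c + m * j \<in> W} \<inter> ?f d ` {j. d + m * j \<in> W} = {}"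
        by auto
    qed
  qed simp
  finally show ?thesis
    by (simp add: card_image inj)
qed

text \<open>Evaluates both bounds: every class contributes \<open>P\<close> code vertices, and the
  classes in \<open>X\<close> one more.\<close>

lemma sum_add_of_bool:
  assumes "X \<subseteq> {..<m}"
  shows "(\<Sum>c<m. P + of_bool (c \<in> X)) = m * P + card (X :: nat set)"
proof -
  have "(\<Sum>c<m. of_bool (c \<in> X)) = card ({..<m} \<inter> X)"
    by simp
  with assms show ?thesis
    by (simp add: sum.distrib Int_absorb1)
qed

section \<open>Residue classes and their forced end vertices\<close>

text \<open>The vertex \<open>c + (2 r + 1) j\<close> with \<open>c \<le> 2 r\<close> is the vertex number \<open>j\<close> of the class of \<open>c\<close>, which
  has \<open>len c\<close> vertices.\<close>

locale path_layout =
  fixes r p q :: nat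
  assumes r: "1 \<le> r" and p: "1 \<le> p" and q: "q \<le> 2 * r"
begin

definition n :: nat where
  "n = (2 * r + 1) * p + q"

definition len :: "nat \<Rightarrow> nat" where
  "len c = (if c < q then p + 1 else p)"

text \<open>The vertex c alone can separate c - r - 1 from c - r, because c - (2 r + 1) is negative;
  this pair exists exactly when r < c.\<close>

definition first_forced :: "nat \<Rightarrow> bool" where
  "first_forced c \<longleftrightarrow> r < c"

text \<open>The last vertex i of the class alone can separate i + r from i + r + 1. The requirement
  i + r + 1 < n is solved for \<open>c\<close> here, which leaves the case proofs only linear
  comparisons of \<open>c\<close>, \<open>q\<close> and \<open>r\<close>.\<close>

definition last_forced :: "nat \<Rightarrow> bool" where
  "last_forced c \<longleftrightarrow> (if c < q then c + r + 1 < q else c < q + r)"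

definition level :: "nat set \<Rightarrow> nat \<Rightarrow> nat set" where
  "level W c = {j. c + (2 * r + 1) * j \<in> W}"

lemma len_pos: "len c \<ge> 1"
  using p by (simp add: len_def)

lemma position_less_iff:
  assumes "c < 2 * r + 1"
  shows "c + (2 * r + 1) * j < n \<longleftrightarrow> j < len c"
proof -
  consider "j < p" | "j = p" | "j > p"
    by linarith
  then show ?thesis
  proof cases
    case 1
    then have "(2 * r + 1) * Suc j \<le> (2 * r + 1) * p"
      by (intro mult_le_mono2) simp
    with 1 assms show ?thesis by (simp add: n_def len_def)
  next
    case 2
    then show ?thesis by (simp add: n_def len_def)
  next
    case 3
    then have "(2 * r + 1) * Suc p \<le> (2 * r + 1) * j"
      by (intro mult_le_mono2) simp
    with 3 q show ?thesis by (simp add: n_def len_def)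
  qed
qed

lemma last_forced_iff:
  "last_forced c \<longleftrightarrow> c + (2 * r + 1) * (len c - 1) + r + 1 < n"
proof -
  have "(2 * r + 1) * p = (2 * r + 1) * (p - 1) + (2 * r + 1)"
    using p by (cases p) simp_all
  then show ?thesis
    unfolding last_forced_def len_def n_def by auto
qed

section \<open>Lower bound for an arbitrary code\<close>

context
  fixes W :: "nat set"
  assumes W: "path_code n r W"
begin

lemma level_subset: "c < 2 * r + 1 \<Longrightarrow> level W c \<subseteq> {..<len c}"
  using W position_less_iff unfolding path_code_def level_def by blast

lemma level_step:
  assumes "c < 2 * r + 1" "Suc j < len c"
  shows "j \<in> level W c \<or> Suc j \<in> level W c"
proof -
  \<comment> \<open>Chosen so that x - r and x + r + 1 are the vertices number \<open>j\<close> and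
    j + 1 of the class.\<close>
  let ?x = "c + (2 * r + 1) * j + r"
  have "c + (2 * r + 1) * Suc j < n"
    using assms position_less_iff by blast
  then have "Suc ?x < n"
    by simp
  then obtain y where "y \<in> W" "y + r = ?x \<or> y = ?x + r + 1"
    using W unfolding path_code_def by blast
  moreover have "?x + r + 1 = c + (2 * r + 1) * Suc j"
    by simp
  ultimately show ?thesis
    unfolding level_def by (metis add_right_cancel mem_Collect_eq)
qed

lemma level_first:
  assumes "c < 2 * r + 1" "first_forced c"
  shows "0 \<in> level W c"
proof -
  have "c + (2 * r + 1) * 0 < n"
    using position_less_iff[OF assms(1), of 0] len_pos[of c] by simp
  then have "Suc (c - r - 1) < n"
    using assms(2) by (simp add: first_forced_def)
  then obtain y where "y \<in> W" "y + r = c - r - 1 \<or> y = c - r - 1 + r + 1"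
    using W unfolding path_code_def by blast
  \<comment> \<open>Since c <= 2 r, the number c - r - 1 is below r, which rules out the first
    alternative.\<close>
  then have "c \<in> W"
    using assms by (auto simp: first_forced_def)
  then show ?thesis
    by (simp add: level_def)
qed

lemma level_last:
  assumes "c < 2 * r + 1" "last_forced c"
  shows "len c - 1 \<in> level W c"
proof -
  define i where "i = c + (2 * r + 1) * (len c - 1)"
  have "Suc (i + r) < n"
    using assms(2) by (simp add: last_forced_iff i_def)
  then obtain y where y: "y \<in> W" "y + r = i + r \<or> y = i + r + r + 1"
    using W unfolding path_code_def by blast
  \<comment> \<open>The other candidate would be the next vertex of the class, which lies beyond the
    path.\<close>
  have "i + r + r + 1 = c + (2 * r + 1) * len c"
    using len_pos[of c] unfolding i_def by (cases "len c") simp_all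
  then have "i + r + r + 1 \<ge> n"
    using position_less_iff[OF assms(1), of "len c"] by simp
  with y have "i \<in> W"
    using W unfolding path_code_def by auto
  then show ?thesis
    by (simp add: level_def i_def)
qed

text \<open>Domination of the vertex 0. The classes c <= r are those whose first vertex separation
  leaves free, so this is where domination can cost an additional vertex.\<close>

lemma first_window: "\<exists>c\<le>r. 0 \<in> level W c"
proof -
  have "0 < n"
    using p by (simp add: n_def)
  then show ?thesis
    using W unfolding path_code_def level_def by fastforce
qed

lemma last_window: "\<exists>y\<in>W. n \<le> y + r + 1"
proof -
  have "0 < n"
    using p by (simp add: n_def)
  then obtain y where "y \<in> W" "n - 1 \<le> y + r"
    using W unfolding path_code_def by (meson diff_less zero_less_one)
  then show ?thesis
    by (intro bexI[of _ y]) linarith+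
qed

lemma card_level_ge:
  assumes "c < 2 * r + 1"
  shows "(len c + of_bool (0 \<in> level W c) + of_bool (len c - 1 \<in> level W c)) div 2 \<le> card (level W c)"
proof -
  have "level W c \<inter> {..<len c} = level W c"
    using level_subset[OF assms] by blast
  then have "len c + of_bool (0 \<in> level W c) + of_bool (len c - 1 \<in> level W c)
      \<le> 2 * card (level W c) + 1"
    using card_vertex_cover_ge[OF len_pos, of c "level W c"] level_step[OF assms] by simp
  then show ?thesis
    by linarith
qed

text \<open>\<open>F\<close> and \<open>L\<close> record end vertices known to lie in
  \<open>W\<close> for another reason than separation, namely domination. The last premise is the
  doubled cover bound of one class, free of division.\<close>

lemma card_code_ge:
  assumes "X \<subseteq> {..<2 * r + 1}"
    and "\<And>c. c \<in> F \<Longrightarrow> 0 \<in> level W c" "\<And>c. c \<in> L \<Longrightarrow> len c - 1 \<in> level W c"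
    and "\<And>c. c < 2 * r + 1 \<Longrightarrow> 2 * (P + of_bool (c \<in> X)) \<le>
      len c + of_bool (c \<in> F \<or> first_forced c) + of_bool (c \<in> L \<or> last_forced c)"
  shows "(2 * r + 1) * P + card X \<le> card W"
proof -
  have "finite W"
    using W finite_subset unfolding path_code_def by blast
  then have "card W = (\<Sum>c<2 * r + 1. card (level W c))"
    unfolding level_def by (rule card_eq_sum_residue_classes) simp
  moreover have "(\<Sum>c<2 * r + 1. P + of_bool (c \<in> X)) \<le> (\<Sum>c<2 * r + 1. card (level W c))"
  proof (rule sum_mono)
    fix c assume "c \<in> {..<2 * r + 1}"
    then have c: "c < 2 * r + 1"
      by simp
    have "of_bool (c \<in> F \<or> first_forced c) \<le> (of_bool (0 \<in> level W c) :: nat)"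
      "of_bool (c \<in> L \<or> last_forced c) \<le> (of_bool (len c - 1 \<in> level W c) :: nat)"
      using assms(2,3) level_first[OF c] level_last[OF c] by auto
    then have *: "2 * (P + of_bool (c \<in> X)) \<le>
        len c + of_bool (0 \<in> level W c) + of_bool (len c - 1 \<in> level W c)"
      using assms(4)[OF c] by linarith
    have "P + of_bool (c \<in> X) = 2 * (P + of_bool (c \<in> X)) div 2"
      by (rule nonzero_mult_div_cancel_left[symmetric]) simp
    also have "\<dots> \<le> card (level W c)"
      using div_le_mono[OF *] card_level_ge[OF c] by (rule order_trans)
    finally show "P + of_bool (c \<in> X) \<le> card (level W c)" .
  qed
  ultimately show ?thesis
    by (simp only: sum_add_of_bool[OF assms(1)])
qed

end

section \<open>Codes from parity patterns\<close>

text \<open>In the class of \<open>c\<close> the code alternates, from the first vertex on if \<open>c \<in> E\<close> and from the second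
  on otherwise; the end vertices added to it lie in every code.\<close>

definition code :: "nat set \<Rightarrow> nat set" where
  "code E = {c + (2 * r + 1) * j | c j. c < 2 * r + 1 \<and> j < len c \<and>
     ((even j \<longleftrightarrow> c \<in> E) \<or> j = 0 \<and> first_forced c \<or> j = len c - 1 \<and> last_forced c)}"

lemma mem_code_iff:
  assumes "c < 2 * r + 1"
  shows "c + (2 * r + 1) * j \<in> code E \<longleftrightarrow> j < len c \<and>
     ((even j \<longleftrightarrow> c \<in> E) \<or> j = 0 \<and> first_forced c \<or> j = len c - 1 \<and> last_forced c)"
proof -
  have "c = d \<and> j = i" if "c + (2 * r + 1) * j = d + (2 * r + 1) * i" "d < 2 * r + 1" for d i
  proof -
    have "(c + (2 * r + 1) * j) mod (2 * r + 1) = c" "(d + (2 * r + 1) * i) mod (2 * r + 1) = d"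
      using assms that(2) by (simp_all only: mod_mult_self2 mod_less)
    then have "c = d"
      using that(1) by metis
    with that(1) have "(2 * r + 1) * j = (2 * r + 1) * i"
      by (simp only: add_left_cancel)
    with \<open>c = d\<close> show ?thesis
      by (simp del: mult_Suc)
  qed
  then show ?thesis
    using assms unfolding code_def by auto
qed

lemma code_subset: "code E \<subseteq> {..<n}"
  unfolding code_def using position_less_iff by auto

text \<open>The extra terms count forced ends that the alternation misses: number 0 if it starts at
  number 1, and number \<open>len c - 1\<close> if that index has the wrong parity.\<close>

lemma card_level_code_le:
  assumes "c < 2 * r + 1"
  shows "card (level (code E) c) \<le> (if c \<in> E then (len c + 1) div 2 else len c div 2) +
    of_bool (c \<notin> E \<and> first_forced c) + of_bool (last_forced c \<and> (even (len c) \<longleftrightarrow> c \<in> E))"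
proof -
  let ?A = "{j. j < len c \<and> (even j \<longleftrightarrow> c \<in> E)}"
  let ?F = "if c \<notin> E \<and> first_forced c then {0 :: nat} else {}"
  let ?L = "if last_forced c \<and> (even (len c) \<longleftrightarrow> c \<in> E) then {len c - 1} else {}"
  have card_if: "card (if b then {x} else {}) = of_bool b" for b and x :: nat
    by simp
  have "even (len c - 1) \<longleftrightarrow> odd (len c)"
    using len_pos[of c] by simp
  then have "level (code E) c \<subseteq> ?A \<union> ?F \<union> ?L"
    unfolding level_def by (simp only: mem_code_iff[OF assms]) auto
  then have "card (level (code E) c) \<le> card (?A \<union> ?F \<union> ?L)"
    by (intro card_mono) auto
  also have "\<dots> \<le> card ?A + card ?F + card ?L"
    by (rule order_trans[OF card_Un_le add_right_mono[OF card_Un_le]])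
  also have "card ?A = (if c \<in> E then (len c + 1) div 2 else len c div 2)"
    by (auto simp: card_even_lessThan card_odd_lessThan)
  finally show ?thesis
    by (simp only: card_if)
qed

lemma card_code_le:
  assumes "X \<subseteq> {..<2 * r + 1}"
    and "\<And>c. c < 2 * r + 1 \<Longrightarrow> (if c \<in> E then (len c + 1) div 2 else len c div 2) +
    of_bool (c \<notin> E \<and> first_forced c) + of_bool (last_forced c \<and> (even (len c) \<longleftrightarrow> c \<in> E))
    \<le> P + of_bool (c \<in> X)"
  shows "card (code E) \<le> (2 * r + 1) * P + card X"
proof -
  have "finite (code E)"
    using code_subset finite_subset by blast
  then have "card (code E) = (\<Sum>c<2 * r + 1. card (level (code E) c))"
    unfolding level_def by (rule card_eq_sum_residue_classes) simp
  also have "\<dots> \<le> (\<Sum>c<2 * r + 1. P + of_bool (c \<in> X))"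
    using card_level_code_le assms(2) by (intro sum_mono) (meson lessThan_iff order_trans)
  also have "\<dots> = (2 * r + 1) * P + card X"
    using assms(1) by (rule sum_add_of_bool)
  finally show ?thesis .
qed

text \<open>A window of \<open>2 r + 1\<close> consecutive vertices meets every class, in one level for the classes from
  some \<open>b\<close> on and in the next level for the classes below \<open>b\<close>. Two of the classes \<open>c1\<close>, \<open>c2\<close>, \<open>c3\<close>
  on the same side of \<open>b\<close> have opposite parity patterns, so one of them contributes a code vertex.\<close>

lemma code_meets_window:
  assumes c: "c1 < c2" "c2 < c3" "c3 < 2 * r + 1"
    and alt: "c1 \<in> E \<longleftrightarrow> c2 \<notin> E" "c3 \<in> E \<longleftrightarrow> c2 \<notin> E"
    and y: "y + 2 * r < n"
  shows "\<exists>z\<in>code E. y \<le> z \<and> z \<le> y + 2 * r"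
proof -
  define a b where "a = y div (2 * r + 1)" and "b = y mod (2 * r + 1)"
  have y_eq: "y = b + (2 * r + 1) * a" and b: "b < 2 * r + 1"
    unfolding a_def b_def by (simp_all only: mod_mult_div_eq) simp
  have mem: "c + (2 * r + 1) * j \<in> code E"
    if "c < 2 * r + 1" "c + (2 * r + 1) * j \<le> y + 2 * r" "even j \<longleftrightarrow> c \<in> E" for c j
    using that y by (subst mem_code_iff) (auto simp: position_less_iff[symmetric] simp del: mult_Suc)
  show ?thesis
  proof (cases "b \<le> c2")
    case True
    define c where "c = (if even a \<longleftrightarrow> c2 \<in> E then c2 else c3)"
    have "b \<le> c" "c < 2 * r + 1" "even a \<longleftrightarrow> c \<in> E"
      using True c alt by (auto simp: c_def)
    then show ?thesis
      using mem[of c a] by (intro bexI[of _ "c + (2 * r + 1) * a"]) (auto simp: y_eq)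
  next
    case False
    define c where "c = (if even (Suc a) \<longleftrightarrow> c2 \<in> E then c2 else c1)"
    have "c < b" "even (Suc a) \<longleftrightarrow> c \<in> E"
      using False c alt by (auto simp: c_def)
    then show ?thesis
      using mem[of c "Suc a"] b
      by (intro bexI[of _ "c + (2 * r + 1) * Suc a"]) (auto simp: y_eq)
  qed
qed

text \<open>Interior vertices are dominated by \<open>code_meets_window\<close>, so only the two
  ends need witnesses: the vertex \<open>c\<close> on the left and \<open>y\<close> on the right.
  Separation follows from the alternation and the forced ends.\<close>

lemma path_code_code:
  assumes alt: "c1 < c2" "c2 < c3" "c3 < 2 * r + 1" "c1 \<in> E \<longleftrightarrow> c2 \<notin> E" "c3 \<in> E \<longleftrightarrow> c2 \<notin> E"
    and first: "c \<in> E" "c \<le> r"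
    and last: "y \<in> code E" "n \<le> y + r + 1"
  shows "path_code n r (code E)"
  unfolding path_code_def
proof (intro conjI allI impI)
  show "code E \<subseteq> {..<n}"
    by (rule code_subset)
  fix x
  show "\<exists>z\<in>code E. x \<le> z + r \<and> z \<le> x + r" if "x < n"
  proof -
    consider "x \<le> r" | "n \<le> x + r + 1" | "r < x" "x + r + 1 < n"
      by linarith
    then show ?thesis
    proof cases
      case 1
      have "c + (2 * r + 1) * 0 \<in> code E"
        using first len_pos[of c] by (subst mem_code_iff) auto
      with 1 first show ?thesis
        by (intro bexI[of _ c]) auto
    next
      case 2
      have "y < n"
        using last(1) code_subset by blast
      with 2 last that show ?thesis
        by (intro bexI[of _ y]) auto
    next
      case 3
      then obtain z where "z \<in> code E" "x - r \<le> z" "z \<le> x - r + 2 * r"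
        using code_meets_window[OF alt, of "x - r"] by auto
      with 3 show ?thesis
        by (intro bexI[of _ z]) auto
    qed
  qed
  show "\<exists>z\<in>code E. z + r = x \<or> z = x + r + 1" if "Suc x < n"
  proof (cases "x < r")
    case True
    have "x + r + 1 + (2 * r + 1) * 0 \<in> code E"
      using True len_pos[of "x + r + 1"] by (subst mem_code_iff) (auto simp: first_forced_def)
    then show ?thesis
      by auto
  next
    case False
    define d j where "d = (x - r) mod (2 * r + 1)" and "j = (x - r) div (2 * r + 1)"
    have "x - r = d + (2 * r + 1) * j" and d: "d < 2 * r + 1"
      unfolding d_def j_def by (simp_all only: mod_mult_div_eq) simp
    then have x: "x = d + (2 * r + 1) * j + r"
      using False by linarith
    have j: "j < len d"
      using that position_less_iff[OF d, of j] by (simp add: x)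
    \<comment> \<open>The separating candidates are numbers \<open>j\<close> and j + 1 of the class
      of \<open>d\<close>. One has the right parity; if \<open>j\<close> is the last number, it is
      forced.\<close>
    consider "even j \<longleftrightarrow> d \<in> E" | "even (Suc j) \<longleftrightarrow> d \<in> E" "Suc j < len d" | "j = len d - 1"
      using j by fastforce
    then show ?thesis
    proof cases
      case 1
      then have "d + (2 * r + 1) * j \<in> code E"
        using j d by (subst mem_code_iff) auto
      then show ?thesis
        by (auto simp: x)
    next
      case 2
      then have "d + (2 * r + 1) * Suc j \<in> code E"
        using d by (subst mem_code_iff) auto
      moreover have "d + (2 * r + 1) * Suc j = x + r + 1"
        by (simp add: x)
      ultimately show ?thesis
        by metis
    next
      case 3
      have "last_forced d"
        using that unfolding last_forced_iff by (simp add: x 3)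
      then have "d + (2 * r + 1) * j \<in> code E"
        using j d 3 by (subst mem_code_iff) auto
      then show ?thesis
        by (auto simp: x)
    qed
  qed
qed

end

section \<open>The six cases\<close>

context path_layout
begin

lemma last_vertex_mem_code:
  assumes "c < q" "even p \<longleftrightarrow> c \<in> E"
  shows "c + (2 * r + 1) * p \<in> code E"
  using assms q by (subst mem_code_iff) (auto simp: len_def)

lemma min_code_zero_even:
  assumes "q = 0" "even p"
  shows "min_identifying_code (path_graph n) r = enat ((2 * r + 1) * p div 2 + 1)"
proof -
  obtain P where P: "p = 2 * P"
    using assms(2) by blast
  have v: "(2 * r + 1) * p div 2 + 1 = (2 * r + 1) * P + 1"
    unfolding P by simp
  have P1: "P \<ge> 1"
    using p P by simp
  have len: "len c = 2 * P" for c
    using assms(1) P unfolding len_def by simp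
  have last: "last_forced c \<longleftrightarrow> c < r" for c
    using assms(1) unfolding last_forced_def by simp
  have n: "n = (2 * r + 1) * (2 * P - 1) + (2 * r + 1)"
    using assms(1) P P1 unfolding n_def by (cases P) simp_all
  \<comment> \<open>The class of r starts with its first vertex and dominates the left end. The
    class of r + 1 gets both its ends, dominates the right end and is the only one with P + 1
    vertices.\<close>
  define E where "E = {c. c = r \<or> r + 2 \<le> c}"
  show ?thesis
    unfolding v
  proof (rule min_identifying_code_path_graphI)
    have "r + 1 + (2 * r + 1) * (2 * P - 1) \<in> code E"
      using r P1 by (subst mem_code_iff) (auto simp: E_def len)
    moreover have "n \<le> r + 1 + (2 * r + 1) * (2 * P - 1) + r + 1"
      unfolding n by linarith
    ultimately show "path_code n r (code E)"
      using r by (intro path_code_code[of "r - 1" r "r + 1" E r]) (auto simp: E_def)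
    have "card (code E) \<le> (2 * r + 1) * P + card {r + 1}"
      using r by (intro card_code_le) (auto simp: E_def len first_forced_def last)
    then show "card (code E) \<le> (2 * r + 1) * P + 1"
      by simp
  next
    fix W assume W: "path_code n r W"
    obtain c where c: "c \<le> r" "0 \<in> level W c"
      using first_window[OF W] by blast
    obtain y where y: "y \<in> W" "n \<le> y + r + 1"
      using last_window[OF W] by blast
    define d j where "d = y mod (2 * r + 1)" and "j = y div (2 * r + 1)"
    have y_eq: "y = d + (2 * r + 1) * j" and d: "d < 2 * r + 1"
      unfolding d_def j_def by (simp_all only: mod_mult_div_eq) simp
    have j: "j \<in> level W d"
      using y(1) by (simp only: level_def mem_Collect_eq y_eq)
    then have "j < 2 * P"
      using level_subset[OF W d] by (auto simp: len)
    moreover have "2 * P - 1 \<le> j"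
    proof (rule ccontr)
      assume "\<not> 2 * P - 1 \<le> j"
      then have "(2 * r + 1) * (j + 1) \<le> (2 * r + 1) * (2 * P - 1)"
        by (intro mult_le_mono2) simp
      then show False
        using y(2) d unfolding y_eq n by simp
    qed
    ultimately have j_eq: "j = 2 * P - 1"
      by simp
    have "r \<le> d"
      using y(2) unfolding y_eq n j_eq by linarith
    \<comment> \<open>Separation forces one end in each class except that of r, which has none
      forced. A class with both ends in \<open>W\<close> needs P + 1 vertices: \<open>c\<close> if c
      < r, as its last vertex is forced; otherwise c = r, and \<open>d\<close> works, either because
      d > r has a forced first vertex or because d = c.\<close>
    define b where "b = (if c < r then c else d)"
    have "(2 * r + 1) * P + card {b} \<le> card W"
    proof (rule card_code_ge[OF W, of _ "{c}" "{d}"])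
      show "2 * (P + of_bool (a \<in> {b})) \<le> len a + of_bool (a \<in> {c} \<or> first_forced a) +
          of_bool (a \<in> {d} \<or> last_forced a)" if "a < 2 * r + 1" for a
        using c(1) \<open>r \<le> d\<close> by (auto simp: b_def len first_forced_def last)
    qed (use c d j j_eq in \<open>auto simp: b_def len\<close>)
    then show "(2 * r + 1) * P + 1 \<le> card W"
      by simp
  qed
qed

text \<open>All classes have 2 P + 1 vertices, so one forced end already costs P + 1, and only the
  class of r has none. Domination is free.\<close>

lemma min_code_zero_odd:
  assumes "q = 0" "odd p"
  shows "min_identifying_code (path_graph n) r = enat ((2 * r + 1) * (p - 1) div 2 + 2 * r)"
proof -
  obtain P where P: "p = 2 * P + 1"
    using assms(2) by (blast elim: oddE)
  have v: "(2 * r + 1) * (p - 1) div 2 + 2 * r = (2 * r + 1) * P + card ({..<2 * r + 1} - {r})"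
    unfolding P by simp
  have len: "len c = 2 * P + 1" for c
    using assms(1) P unfolding len_def by simp
  have last: "last_forced c \<longleftrightarrow> c < r" for c
    using assms(1) unfolding last_forced_def by simp
  have n: "n = (2 * r + 1) * (2 * P) + (2 * r + 1)"
    using assms(1) P unfolding n_def by simp
  define E where "E = - {r}"
  show ?thesis
    unfolding v
  proof (rule min_identifying_code_path_graphI)
    have "2 * r + (2 * r + 1) * (2 * P) \<in> code E"
      using r by (subst mem_code_iff) (auto simp: E_def len)
    moreover have "n \<le> 2 * r + (2 * r + 1) * (2 * P) + r + 1"
      unfolding n by linarith
    ultimately show "path_code n r (code E)"
      using r by (intro path_code_code[of "r - 1" r "r + 1" E 0]) (auto simp: E_def)
    show "card (code E) \<le> (2 * r + 1) * P + card ({..<2 * r + 1} - {r})"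
      by (intro card_code_le) (auto simp: E_def len first_forced_def last)
  next
    fix W assume W: "path_code n r W"
    show "(2 * r + 1) * P + card ({..<2 * r + 1} - {r}) \<le> card W"
      by (intro card_code_ge[OF W, of _ "{}" "{}"]) (auto simp: len first_forced_def last)
  qed
qed

text \<open>Separation forces both ends of the q - 1 classes r < c < q + r, each of even length.
  Dominating the vertex 0 puts the first vertex of some class c <= r into the code: this class has
  odd length, or its last vertex is forced, so it too needs P + 1.\<close>

lemma min_code_small_even:
  assumes "1 \<le> q" "q \<le> r + 1" "even p"
  shows "min_identifying_code (path_graph n) r = enat ((2 * r + 1) * p div 2 + q)"
proof -
  obtain P where P: "p = 2 * P"
    using assms(3) by blast
  have v: "(2 * r + 1) * p div 2 + q = (2 * r + 1) * P + q"
    unfolding P by simp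
  have len: "len c = (if c < q then 2 * P + 1 else 2 * P)" for c
    using P unfolding len_def by simp
  have card: "card (insert c {r + 1..<q + r}) = q" if "c \<le> r" for c
    using that assms(1) by simp
  \<comment> \<open>The class of q - 1 contains both q - 1 <= r and the last vertex of the path;
    starting it at its first vertex dominates both ends.\<close>
  define E where "E = {c. c = q - 1 \<or> q + r \<le> c}"
  show ?thesis
    unfolding v
  proof (rule min_identifying_code_path_graphI)
    have last: "q - 1 + (2 * r + 1) * p \<in> code E" "n \<le> q - 1 + (2 * r + 1) * p + r + 1"
      using assms by (intro last_vertex_mem_code) (simp_all add: E_def n_def)
    show "path_code n r (code E)"
    \<comment> \<open>If q = r + 1, no class satisfies q + r <= c, so the alternating triple has to
      surround the class of r.\<close>
    proof (cases "q \<le> r")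
      case True
      with assms show ?thesis
        by (intro path_code_code[OF _ _ _ _ _ _ _ last, of "q - 1" q "2 * r" "q - 1"])
          (auto simp: E_def)
    next
      case False
      with assms r show ?thesis
        by (intro path_code_code[OF _ _ _ _ _ _ _ last, of 0 r "r + 1" r]) (auto simp: E_def)
    qed
    have "card (code E) \<le> (2 * r + 1) * P + card (insert (q - 1) {r + 1..<q + r})"
      using assms(1,2) by (intro card_code_le) (auto simp: E_def len first_forced_def last_forced_def)
    moreover have "q - 1 \<le> r"
      using assms(2) by simp
    ultimately show "card (code E) \<le> (2 * r + 1) * P + q"
      by (simp only: card)
  next
    fix W assume W: "path_code n r W"
    obtain c where c: "c \<le> r" "0 \<in> level W c"
      using first_window[OF W] by blast
    have "(2 * r + 1) * P + card (insert c {r + 1..<q + r}) \<le> card W"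
      using assms(1,2) c by (intro card_code_ge[OF W, of _ "{c}" "{}"])
        (auto simp: len first_forced_def last_forced_def)
    then show "(2 * r + 1) * P + q \<le> card W"
      by (simp only: card[OF c(1)])
  qed
qed

text \<open>Every class needs P + 1 vertices: those below q have 2 P + 2, and the others have 2 P +
  1 with at least one forced end.\<close>

lemma card_code_ge_odd:
  assumes "1 \<le> q" "odd p" "path_code n r W"
  shows "(2 * r + 1) * (p - 1) div 2 + 2 * r + 1 \<le> card W"
proof -
  obtain P where P: "p = 2 * P + 1"
    using assms(2) by (blast elim: oddE)
  have v: "(2 * r + 1) * (p - 1) div 2 + 2 * r + 1 = (2 * r + 1) * P + card {..<2 * r + 1}"
    unfolding P by simp
  have len: "len c = (if c < q then 2 * P + 2 else 2 * P + 1)" for c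
    using P unfolding len_def by simp
  show ?thesis
    unfolding v using assms(1) by (intro card_code_ge[OF assms(3), of _ "{}" "{}"])
      (auto simp: len first_forced_def last_forced_def)
qed

lemma min_code_small_odd:
  assumes "1 \<le> q" "q \<le> r + 1" "odd p"
  shows "min_identifying_code (path_graph n) r = enat ((2 * r + 1) * (p - 1) div 2 + 2 * r + 1)"
proof -
  obtain P where P: "p = 2 * P + 1"
    using assms(3) by (blast elim: oddE)
  have v: "(2 * r + 1) * (p - 1) div 2 + 2 * r + 1 = (2 * r + 1) * P + card {..<2 * r + 1}"
    unfolding P by simp
  have len: "len c = (if c < q then 2 * P + 2 else 2 * P + 1)" for c
    using P unfolding len_def by simp
  \<comment> \<open>As \<open>p\<close> is odd, the last vertex of the path is included when q - 1
    is outside \<open>E\<close>. For q = 1 this excludes 0, so other classes dominate the left end,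
    and stopping at r keeps an alternating triple.\<close>
  define E where "E = (if q = 1 then {1..r} else {c. c = 0 \<or> q \<le> c})"
  show ?thesis
  proof (rule min_identifying_code_path_graphI)
    have last: "q - 1 + (2 * r + 1) * p \<in> code E" "n \<le> q - 1 + (2 * r + 1) * p + r + 1"
      using assms by (intro last_vertex_mem_code) (auto simp: E_def n_def)
    show "path_code n r (code E)"
    proof (cases "q = 1")
      case True
      show ?thesis
        using r by (intro path_code_code[OF _ _ _ _ _ _ _ last, of 0 1 "r + 1" 1])
          (simp_all add: E_def True)
    next
      case False
      with assms(1,2) r show ?thesis
        by (intro path_code_code[OF _ _ _ _ _ _ _ last, of 0 1 q 0]) (auto simp: E_def)
    qed
    show "card (code E) \<le> (2 * r + 1) * (p - 1) div 2 + 2 * r + 1"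
      unfolding v using assms(1,2)
      by (intro card_code_le) (auto simp: E_def len first_forced_def last_forced_def)
  qed (rule card_code_ge_odd[OF assms(1,3)])
qed

lemma min_code_large_even:
  assumes "r + 2 \<le> q" "even p"
  shows "min_identifying_code (path_graph n) r = enat ((2 * r + 1) * p div 2 + q - 1)"
proof -
  obtain P where P: "p = 2 * P"
    using assms(2) by blast
  \<comment> \<open>Exactly the classes where forced ends raise the minimum to P + 1: one forced end
    and odd length below q, two forced ends and even length from q on.\<close>
  define E where "E = {..<q - r - 1} \<union> {r + 1..<2 * r + 1}"
  have "card E = q - 1"
    unfolding E_def using assms(1) q by (subst card_Un_disjoint) auto
  then have v: "(2 * r + 1) * p div 2 + q - 1 = (2 * r + 1) * P + card E"
    using assms(1) unfolding P by (simp add: algebra_simps)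
  have len: "len c = (if c < q then 2 * P + 1 else 2 * P)" for c
    using P unfolding len_def by simp
  show ?thesis
    unfolding v
  proof (rule min_identifying_code_path_graphI)
    have last: "q - 1 + (2 * r + 1) * p \<in> code E" "n \<le> q - 1 + (2 * r + 1) * p + r + 1"
      using assms q by (intro last_vertex_mem_code) (auto simp: E_def n_def)
    show "path_code n r (code E)"
      using assms(1) q by (intro path_code_code[OF _ _ _ _ _ _ _ last, of 0 r "r + 1" 0])
        (auto simp: E_def)
    show "card (code E) \<le> (2 * r + 1) * P + card E"
      using assms(1) q by (intro card_code_le)
        (auto simp: E_def len first_forced_def last_forced_def)
  next
    fix W assume W: "path_code n r W"
    show "(2 * r + 1) * P + card E \<le> card W"
      using assms(1) q by (intro card_code_ge[OF W, of _ "{}" "{}"])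
        (auto simp: E_def len first_forced_def last_forced_def)
  qed
qed

lemma min_code_large_odd:
  assumes "r + 2 \<le> q" "odd p"
  shows "min_identifying_code (path_graph n) r = enat ((2 * r + 1) * (p - 1) div 2 + 2 * r + 1)"
proof -
  obtain P where P: "p = 2 * P + 1"
    using assms(2) by (blast elim: oddE)
  have v: "(2 * r + 1) * (p - 1) div 2 + 2 * r + 1 = (2 * r + 1) * P + card {..<2 * r + 1}"
    unfolding P by simp
  have len: "len c = (if c < q then 2 * P + 2 else 2 * P + 1)" for c
    using P unfolding len_def by simp
  \<comment> \<open>The class of q - r - 1 <= r dominates the left end, and its last vertex is not
    forced. The class of q - r lies outside \<open>E\<close> and supplies the vertex n - r for the
    right end.\<close>
  define E where "E = {c. c = q - r - 1 \<or> r + 1 \<le> c}"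
  show ?thesis
  proof (rule min_identifying_code_path_graphI)
    have last: "q - r + (2 * r + 1) * p \<in> code E" "n \<le> q - r + (2 * r + 1) * p + r + 1"
      using assms q r by (intro last_vertex_mem_code) (auto simp: E_def n_def)
    show "path_code n r (code E)"
      using assms(1) q r
      by (intro path_code_code[OF _ _ _ _ _ _ _ last, of 0 "q - r - 1" "q - r" "q - r - 1"])
        (auto simp: E_def)
    show "card (code E) \<le> (2 * r + 1) * (p - 1) div 2 + 2 * r + 1"
      unfolding v using assms(1) q
      by (intro card_code_le) (auto simp: E_def len first_forced_def last_forced_def)
  qed (use assms card_code_ge_odd in auto)
qed

end

theorem theorem11:
  fixes r n p q :: nat
  assumes "r \<ge> 1" and "p \<ge> 1" and "q \<le> 2 * r" and "n = (2 * r + 1) * p + q"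
  shows
    "(q = 0 \<longrightarrow>
        (even p \<longrightarrow>
           min_identifying_code (path_graph n) r = enat ((2 * r + 1) * p div 2 + 1)) \<and>
        (odd p \<longrightarrow>
           min_identifying_code (path_graph n) r = enat ((2 * r + 1) * (p - 1) div 2 + 2 * r))) \<and>
     (1 \<le> q \<and> q \<le> r + 1 \<longrightarrow>
        (even p \<longrightarrow>
           min_identifying_code (path_graph n) r = enat ((2 * r + 1) * p div 2 + q)) \<and>
        (odd p \<longrightarrow>
           min_identifying_code (path_graph n) r = enat ((2 * r + 1) * (p - 1) div 2 + 2 * r + 1))) \<and>
     (r + 2 \<le> q \<and> q \<le> 2 * r \<longrightarrow>
        (even p \<longrightarrow>
           min_identifying_code (path_graph n) r = enat ((2 * r + 1) * p div 2 + q - 1)) \<and>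
        (odd p \<longrightarrow>
           min_identifying_code (path_graph n) r = enat ((2 * r + 1) * (p - 1) div 2 + 2 * r + 1)))"
proof -
  interpret path_layout r p q
    using assms(1-3) by unfold_locales
  have "n = path_layout.n r p q"
    by (simp only: assms(4) n_def)
  then show ?thesis
    using min_code_zero_even min_code_zero_odd min_code_small_even min_code_small_odd
      min_code_large_even min_code_large_odd by blast
qed

end
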